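(* Let $1\to H\to G\xrightarrow{\pi}K\to 1$ be an extension of finitely generated groups $H$ and $K$, and let $A$ be a finite symmetric generating set for $G$. If there exist $a\in\pi(A)$ and a word $w\in\pi(A)^*$ such that the word $awa^{-1}$ is geodesic in $K$ over the generating set $\pi(A)$, then the geodesic language $\mathsf{Geo}(G,A)$ is not piecewise excluding.
   Context: A generating set $A$ of a group $G$ is symmetric if it is inverse-closed: $A$ is a subset of $G$ generating $G$ and $a\in A$ implies $a^{-1}\in A$ (the identity element is allowed to belong to $A$). $A^*$ denotes the set of all finite words over the alphabet $A$, including the empty word. A word $w\in A^*$ is geodesic if it labels a path of minimal length between two vertices of the Cayley graph of $G$ over $A$; equivalently, no strictly shorter word over $A$ represents the same element of $G$ as $w$. The geodesic language $\mathsf{Geo}(G,A)\subseteq A^*$ is the set of all geodesic words. A word $a_1a_2\cdots a_n$ ($a_i\in A$) is a piecewise subword of $w\in A^*$ if $w=w_0a_1w_1a_2\cdots a_nw_n$ for some $w_i\in A^*$ (i.e. it is a not necessarily contiguous subsequence of $w$). A language $L\subseteq A^*$ is piecewise excluding if there is a finite set $F\subset A^*$ such that, for all $w\in A^*$, $w\in L$ if and only if $w$ contains no piecewise subword in $F$. The word $awa^{-1}$ over $\pi(A)$ means the concatenation of the letter $a$, the word $w$, and the letter $a^{-1}\in\pi(A)$. *)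

theory Defs
  imports "HOL-Algebra.Exact_Sequence" "HOL-Library.Sublist"
begin

definition fin_gen_group :: "('a, 'x) monoid_scheme \<Rightarrow> bool"
  where "fin_gen_group G \<longleftrightarrow>
    group G \<and> (\<exists>S. finite S \<and> S \<subseteq> carrier G \<and> generate G S = carrier G)"

text \<open>The library's \<^const>\<open>short_exact_sequence\<close> forces all groups to have the same element type.
  The following version allows three different element types; the lemma below shows
  that it agrees with the library's notion where both make sense.\<close>

definition group_extension ::
  "('h, 'x) monoid_scheme \<Rightarrow> ('g, 'y) monoid_scheme \<Rightarrow> ('k, 'z) monoid_scheme \<Rightarrow>
    ('h \<Rightarrow> 'g) \<Rightarrow> ('g \<Rightarrow> 'k) \<Rightarrow> bool"
  where "group_extension H G K \<iota> \<pi> \<longleftrightarrow>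
    group H \<and> group G \<and> group K \<and>
    \<iota> \<in> mon H G \<and> \<pi> \<in> epi G K \<and> \<iota> ` carrier H = kernel G K \<pi>"

lemma short_exact_sequence_iff_group_extension:
  "short_exact_sequence K G H \<pi> \<iota> \<longleftrightarrow> group_extension H G K \<iota> \<pi>"
  by (auto simp: short_exact_sequence_iff group_extension_def group_hom_def
      group_hom_axioms_def mon_def epi_def)

definition symmetric_gen_set :: "('a, 'x) monoid_scheme \<Rightarrow> 'a set \<Rightarrow> bool"
  where "symmetric_gen_set G A \<longleftrightarrow>
    A \<subseteq> carrier G \<and> generate G A = carrier G \<and> (\<forall>a\<in>A. inv\<^bsub>G\<^esub> a \<in> A)"

text \<open>Words over \<open>A\<close> are elements of \<^term>\<open>lists A\<close>.  The word \<open>w\<close> labels a path from the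
  vertex \<open>g\<close> to the vertex \<open>h\<close> in the (right) Cayley graph, whose edges are
  \<open>g \<longrightarrow> g \<otimes> a\<close>, labelled by \<open>a \<in> A\<close>.\<close>

fun cayley_path ::
  "('a, 'x) monoid_scheme \<Rightarrow> 'a set \<Rightarrow> 'a \<Rightarrow> 'a list \<Rightarrow> 'a \<Rightarrow> bool"
  where
    "cayley_path G A g [] h \<longleftrightarrow> g \<in> carrier G \<and> g = h"
  | "cayley_path G A g (a # w) h \<longleftrightarrow>
      g \<in> carrier G \<and> a \<in> A \<and> cayley_path G A (g \<otimes>\<^bsub>G\<^esub> a) w h"

definition geodesic :: "('a, 'x) monoid_scheme \<Rightarrow> 'a set \<Rightarrow> 'a list \<Rightarrow> bool"
  where "geodesic G A w \<longleftrightarrow>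
    (\<exists>g\<in>carrier G. \<exists>h\<in>carrier G. cayley_path G A g w h \<and>
      (\<forall>v. cayley_path G A g v h \<longrightarrow> length w \<le> length v))"

definition Geo :: "('a, 'x) monoid_scheme \<Rightarrow> 'a set \<Rightarrow> 'a list set"
  where "Geo G A = {w \<in> lists A. geodesic G A w}"

definition piecewise_excluding :: "'a set \<Rightarrow> 'a list set \<Rightarrow> bool"
  where "piecewise_excluding A L \<longleftrightarrow>
    L \<subseteq> lists A \<and>
    (\<exists>F. finite F \<and> F \<subseteq> lists A \<and>
      (\<forall>w\<in>lists A. w \<in> L \<longleftrightarrow> \<not> (\<exists>u\<in>F. subseq u w)))"

definition word_eval :: "('a, 'x) monoid_scheme \<Rightarrow> 'a list \<Rightarrow> 'a"
  where "word_eval G w = foldr (\<otimes>\<^bsub>G\<^esub>) w \<one>\<^bsub>G\<^esub>"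

lemma word_eval_closed:
  assumes "group G" "w \<in> lists (carrier G)"
  shows "word_eval G w \<in> carrier G"
proof -
  interpret group G by fact
  show ?thesis using assms(2) by (induction w) (auto simp: word_eval_def)
qed

lemma cayley_path_iff:
  assumes "group G" "A \<subseteq> carrier G" "g \<in> carrier G"
  shows "cayley_path G A g w h \<longleftrightarrow> w \<in> lists A \<and> h = g \<otimes>\<^bsub>G\<^esub> word_eval G w"
proof -
  interpret group G by fact
  show ?thesis using assms(3)
  proof (induction w arbitrary: g)
    case Nil
    then show ?case by (auto simp: word_eval_def)
  next
    case (Cons a w)
    show ?case
    proof (cases "a \<in> A \<and> w \<in> lists A")
      case True
      then have "word_eval G w \<in> carrier G" "a \<in> carrier G"
        using assms(2) word_eval_closed[OF assms(1), of w] by auto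
      then show ?thesis using True Cons by (auto simp: word_eval_def m_assoc)
    next
      case False
      then show ?thesis using Cons assms(2) by auto
    qed
  qed
qed

lemma geodesic_iff:
  assumes "group G" "A \<subseteq> carrier G"
  shows "geodesic G A w \<longleftrightarrow>
    w \<in> lists A \<and> \<not> (\<exists>v\<in>lists A. length v < length w \<and> word_eval G v = word_eval G w)"
proof -
  interpret group G by fact
  have cl: "word_eval G v \<in> carrier G" if "v \<in> lists A" for v
    using that assms(2) word_eval_closed[OF assms(1), of v] by auto
  show ?thesis
  proof
    assume "geodesic G A w"
    then show "w \<in> lists A \<and>
        \<not> (\<exists>v\<in>lists A. length v < length w \<and> word_eval G v = word_eval G w)"
      unfolding geodesic_def using cayley_path_iff[OF assms] by (metis not_le)
  next
    assume R: "w \<in> lists A \<and>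
        \<not> (\<exists>v\<in>lists A. length v < length w \<and> word_eval G v = word_eval G w)"
    show "geodesic G A w"
      unfolding geodesic_def
    proof (rule bexI[of _ "\<one>\<^bsub>G\<^esub>"], rule bexI[of _ "word_eval G w"], intro conjI allI impI)
      show "cayley_path G A \<one>\<^bsub>G\<^esub> w (word_eval G w)"
        using R cl by (simp add: cayley_path_iff[OF assms])
      fix v assume "cayley_path G A \<one>\<^bsub>G\<^esub> v (word_eval G w)"
      then have "v \<in> lists A \<and> word_eval G w = word_eval G v"
        using cl by (auto simp: cayley_path_iff[OF assms])
      then show "length w \<le> length v" using R by (metis not_le)
    qed (use R cl in auto)
  qed
qed

end

theory Submission
  imports Defs
begin

text \<open>Piecewise excluding languages are closed under piecewise subwords. A geodesic
  \<open>a w a\<inverse>\<close> of the quotient lifts letter by letter to a geodesic \<open>b v b\<inverse>\<close> of \<open>G\<close>, which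
  contains the non-geodesic word \<open>b b\<inverse>\<close> as a piecewise subword.\<close>

text \<open>By transitivity of \<open>subseq\<close>, a forbidden piecewise subword of
  \<open>u\<close> would also be one of \<open>w\<close>.\<close>

lemma piecewise_excluding_subseq_closed:
  assumes "piecewise_excluding A L" "w \<in> L" "subseq u w"
  shows "u \<in> L"
proof -
  from assms(1) obtain F where F: "L \<subseteq> lists A"
      "\<forall>w\<in>lists A. w \<in> L \<longleftrightarrow> \<not> (\<exists>u\<in>F. subseq u w)"
    unfolding piecewise_excluding_def by blast
  have w: "w \<in> lists A" using F(1) assms(2) by blast
  \<comment> \<open>The criterion given by \<open>F\<close> decides membership in \<open>L\<close>
    only for words over \<open>A\<close>, so \<open>u\<close> must first be seen to be one.\<close>
  moreover have "set u \<subseteq> set w" using assms(3) by (auto elim: list_emb_set)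
  ultimately have "u \<in> lists A" by (auto simp: in_lists_conv_set)
  then show ?thesis using F(2) w assms(2,3) by (meson subseq_order.trans)
qed

lemma word_eval_map_hom:
  assumes "group_hom G K h" "w \<in> lists (carrier G)"
  shows "word_eval K (map h w) = h (word_eval G w)"
proof -
  interpret group_hom G K h by fact
  show ?thesis using assms(2)
  proof (induction w)
    case Nil
    then show ?case by (simp add: word_eval_def)
  next
    case (Cons x w)
    then have "word_eval G w \<in> carrier G" by (auto intro: word_eval_closed G.is_group)
    then show ?case using Cons by (simp add: word_eval_def)
  qed
qed

text \<open>Applying \<open>h\<close> letter by letter preserves length and equality of values, so a
  shortcut for \<open>w\<close> in \<open>G\<close> would map to a shortcut for
  \<open>map h w\<close> in \<open>K\<close>.\<close>

lemma geodesic_map_homD: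
  assumes "group_hom G K h" "A \<subseteq> carrier G" "w \<in> lists A" "geodesic K (h ` A) (map h w)"
  shows "geodesic G A w"
proof -
  interpret group_hom G K h by fact
  have img: "h ` A \<subseteq> carrier K" using assms(2) by auto
  have ev: "word_eval K (map h v) = h (word_eval G v)" if "v \<in> lists A" for v
    using that assms(2) by (intro word_eval_map_hom[OF assms(1)]) auto
  have False if v: "v \<in> lists A" "length v < length w" "word_eval G v = word_eval G w" for v
  proof -
    have "map h v \<in> lists (h ` A)" using v(1) by auto
    moreover have "word_eval K (map h v) = word_eval K (map h w)"
      using v assms(3) by (simp add: ev)
    ultimately show False
      using assms(4) v(2) geodesic_iff[OF H.is_group img] by (metis length_map)
  qed
  then show ?thesis using assms(3) geodesic_iff[OF G.is_group assms(2)] by blast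
qed

text \<open>The empty word is shorter and also evaluates to the identity.\<close>

lemma not_geodesic_inverse_pair:
  assumes "group G" "A \<subseteq> carrier G" "a \<in> carrier G"
  shows "\<not> geodesic G A [a, inv\<^bsub>G\<^esub> a]"
proof -
  interpret group G by fact
  have "word_eval G [] = word_eval G [a, inv\<^bsub>G\<^esub> a]"
    using assms(3) by (simp add: word_eval_def)
  then show ?thesis using geodesic_iff[OF assms(1,2)]
    by (metis length_Cons lists.Nil list.size(3) zero_less_Suc)
qed

theorem proposition3p11:
  fixes H :: "('h, 'x) monoid_scheme"
    and G :: "('g, 'y) monoid_scheme"
    and K :: "('k, 'z) monoid_scheme"
    and \<iota> :: "'h \<Rightarrow> 'g" and \<pi> :: "'g \<Rightarrow> 'k" and A :: "'g set"
  assumes "fin_gen_group H" and "fin_gen_group K"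
    and "group_extension H G K \<iota> \<pi>"
    and "finite A" and "symmetric_gen_set G A"
    and "\<exists>a\<in>\<pi> ` A. \<exists>w\<in>lists (\<pi> ` A). geodesic K (\<pi> ` A) ([a] @ w @ [inv\<^bsub>K\<^esub> a])"
  shows "\<not> piecewise_excluding A (Geo G A)"
proof
  assume pe: "piecewise_excluding A (Geo G A)"
  have hom: "group_hom G K \<pi>"
    using assms(3) by (auto simp: group_extension_def group_hom_def group_hom_axioms_def epi_def)
  interpret group_hom G K \<pi> by fact
  have A: "A \<subseteq> carrier G" and inv_A: "\<And>b. b \<in> A \<Longrightarrow> inv\<^bsub>G\<^esub> b \<in> A"
    using assms(5) by (auto simp: symmetric_gen_set_def)
  obtain b v where b: "b \<in> A" and v: "v \<in> lists A"
    and geo: "geodesic K (\<pi> ` A) ([\<pi> b] @ map \<pi> v @ [inv\<^bsub>K\<^esub> (\<pi> b)])"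
    using assms(6) by (auto simp: lists_image)
  have b': "b \<in> carrier G" using b A by blast
  let ?u = "[b] @ v @ [inv\<^bsub>G\<^esub> b]"
  \<comment> \<open>Symmetry of \<open>A\<close> makes the inverse of \<open>b\<close> a letter, so
    the last letter can be lifted to the inverse of the first lift rather than to an arbitrary
    preimage.\<close>
  have u: "?u \<in> lists A" using b v inv_A by simp
  \<comment> \<open>Since \<open>\<pi>\<close> commutes with inverses, \<open>map \<pi> ?u\<close>
    is exactly the word in \<open>geo\<close>.\<close>
  moreover have "geodesic G A ?u"
    using geodesic_map_homD[OF hom A u] geo b' by simp
  ultimately have "?u \<in> Geo G A" by (simp add: Geo_def)
  moreover have "subseq [b, inv\<^bsub>G\<^esub> b] ?u"
    by (auto intro: list_emb_append2)
  ultimately have "[b, inv\<^bsub>G\<^esub> b] \<in> Geo G A"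
    by (rule piecewise_excluding_subseq_closed[OF pe])
  then show False
    using not_geodesic_inverse_pair[OF G.is_group A b'] by (simp add: Geo_def)
qed

end
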